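(* There exists a separable Bellamy continuum.
   Context: A continuum is a nondegenerate (more than one point) compact connected Hausdorff space; a subcontinuum is a subspace that is itself a continuum. A continuum is indecomposable if it is not the union of two proper subcontinua. The composant $\kappa(x)$ of a point $x$ of a continuum $X$ is the union of all proper subcontinua of $X$ that contain $x$. A Bellamy continuum is an indecomposable (Hausdorff) continuum with exactly one composant. A space is separable if it has a countable dense subset. *)

theory Defs
  imports "HOL-Analysis.Analysis"
begin

definition continuum_space :: "'a topology \<Rightarrow> bool" where
  "continuum_space X \<longleftrightarrow>
     compact_space X \<and> connected_space X \<and> Hausdorff_space X \<and>
     (\<exists>x\<in>topspace X. \<exists>y\<in>topspace X. x \<noteq> y)"

text \<open>
  As continua are nondegenerate, neither singletons nor the empty set are subcontinua.
\<close>

definition subcontinuum :: "'a topology \<Rightarrow> 'a set \<Rightarrow> bool" where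
  "subcontinuum X S \<longleftrightarrow> S \<subseteq> topspace X \<and> continuum_space (subtopology X S)"

definition proper_subcontinuum :: "'a topology \<Rightarrow> 'a set \<Rightarrow> bool" where
  "proper_subcontinuum X S \<longleftrightarrow> subcontinuum X S \<and> S \<noteq> topspace X"

definition indecomposable_continuum :: "'a topology \<Rightarrow> bool" where
  "indecomposable_continuum X \<longleftrightarrow>
     continuum_space X \<and>
     \<not> (\<exists>A B. proper_subcontinuum X A \<and> proper_subcontinuum X B \<and> topspace X = A \<union> B)"

definition composant :: "'a topology \<Rightarrow> 'a \<Rightarrow> 'a set" where
  "composant X x = \<Union>{S. proper_subcontinuum X S \<and> x \<in> S}"

definition Bellamy_continuum :: "'a topology \<Rightarrow> bool" where
  "Bellamy_continuum X \<longleftrightarrow>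
     indecomposable_continuum X \<and> (\<exists>!C. C \<in> composant X ` topspace X)"

text \<open>
  HOL cannot quantify existentially over types, so an existence statement about separable
  Hausdorff spaces needs a fixed carrier type. The type \<open>nat set set\<close> loses no generality: if
  \<open>D\<close> is a countable dense subset of a Hausdorff space, then mapping a point \<open>x\<close> to the set of
  all traces \<open>N \<inter> D\<close> of neighbourhoods \<open>N\<close> of \<open>x\<close> is injective, so every separable Hausdorff
  space is homeomorphic to one whose points have that type.
\<close>

end

theory Submission
  imports Defs
begin

text \<open>
  The continuum is the closure of a curve. For a set \<open>N\<close> of natural numbers let \<open>tent N\<close> be the
  function on the line with a bump of height 1 at every sum of finitely many distinct powers
  \<open>4 ^ (n + 1)\<close> with \<open>n \<in> N\<close>. The sets \<open>N\<close> range over a fixed filter, and the point with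
  parameter \<open>s\<close> on the curve has the coordinates \<open>tent N (s + r)\<close>, for \<open>N\<close> in the filter and
  \<open>r\<close> real. The closure of such a curve in a product of intervals is compact, connected and
  separable, and translation acts on it.

  Finitely many members of the filter have infinitely many elements \<open>n\<close> in common, and translating
  by \<open>4 ^ (n + 1)\<close> for large \<open>n\<close> of this kind changes nothing that the corresponding rows can see.
  So the curve returns arbitrarily late to every open set that it meets. For this reason a proper
  subcontinuum has no interior: the returns to an open set outside of it can be used to cut it
  between two returns to its interior (\<open>connected_with_interior_contains_curve\<close>). Hence the closure
  is indecomposable.

  The bumps lie far to the right for very negative \<open>s\<close>, so the curve starts at the point 0.
  Moreover the bumps have long gaps everywhere, so the backward ray of each point \<open>x\<close>, the closure
  of its translates to the left, contains 0 (\<open>zero_in_backward_ray\<close>). It remains to see that this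
  ray is never the whole space (\<open>backward_ray_proper\<close>). A bump of \<open>x\<close> is a limit of bumps at finite
  sums, and the set of digits of these sums has a limit, too. If this limit is finite, then \<open>x\<close> has no
  bumps far to the left. If it is infinite, then only rows \<open>N\<close> that contain almost all of it can be
  different from zero in \<open>x\<close>; as no infinite set is almost contained in all members of the filter,
  some row of \<open>x\<close> vanishes. In both cases a row of \<open>x\<close> vanishes on a left half line, which
  remains true for all translates to the left but fails on the curve.

  Consequently any two points lie in a union of proper subcontinua through 0, which is proper by
  indecomposability, and there is only one composant. The argument needs uncountably many rows:
  every countable family of members of the filter has a pseudo-intersection, and a metrizable
  indecomposable continuum has uncountably many composants. The last step copies the space to the
  required type.
\<close>

section \<open>Sums of distinct powers of four\<close>

definition four_sum :: "nat set \<Rightarrow> real" where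
  "four_sum A = (\<Sum>n\<in>A. 4 ^ (n + 1))"

lemma four_sum_empty [simp]: "four_sum {} = 0"
  by (simp add: four_sum_def)

lemma four_sum_singleton [simp]: "four_sum {n} = 4 ^ (n + 1)"
  by (simp add: four_sum_def)

lemma four_sum_nonneg: "0 \<le> four_sum A"
  by (simp add: four_sum_def sum_nonneg)

lemma four_sum_Un_disjoint:
  "finite A \<Longrightarrow> finite B \<Longrightarrow> A \<inter> B = {} \<Longrightarrow> four_sum (A \<union> B) = four_sum A + four_sum B"
  by (simp add: four_sum_def sum.union_disjoint)

lemma four_sum_mono: "finite B \<Longrightarrow> A \<subseteq> B \<Longrightarrow> four_sum A \<le> four_sum B"
  unfolding four_sum_def by (rule sum_mono2) auto

lemma four_sum_ge_power: "finite A \<Longrightarrow> n \<in> A \<Longrightarrow> 4 ^ (n + 1) \<le> four_sum A"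
  using four_sum_mono[of A "{n}"] by simp

lemma four_sum_lessThan: "four_sum {..<M} = (4 ^ (M + 1) - 4) / 3"
  by (induction M) (simp_all add: four_sum_def)

lemma four_sum_le_below: "A \<subseteq> {..<M} \<Longrightarrow> four_sum A \<le> (4 ^ (M + 1) - 4) / 3"
  using four_sum_mono[of "{..<M}" A] by (simp add: four_sum_lessThan)

lemma four_sum_split: "finite A \<Longrightarrow> four_sum A = four_sum (A \<inter> {..<M}) + four_sum (A \<inter> {M..})"
  by (subst four_sum_Un_disjoint[symmetric]) (auto intro!: arg_cong[of _ _ four_sum])

text \<open>
  The largest power in which two sums differ exceeds everything below it, because the lower powers
  add up to less than a third of it.
\<close>

lemma four_sum_gap:
  assumes "finite A" "finite B" "n \<in> A" "n \<notin> B" and above: "\<And>j. j > n \<Longrightarrow> j \<in> A \<longleftrightarrow> j \<in> B"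
  shows "four_sum A - four_sum B \<ge> (2 * 4 ^ (n + 1) + 4) / 3"
proof -
  have "A \<inter> {n..} = {n} \<union> (B \<inter> {n..})"
    using assms by (force simp: le_less)
  then have "four_sum (A \<inter> {n..}) = 4 ^ (n + 1) + four_sum (B \<inter> {n..})"
    using assms four_sum_Un_disjoint[of "{n}" "B \<inter> {n..}"] by auto
  moreover have "four_sum (B \<inter> {..<n}) \<le> (4 ^ (n + 1) - 4) / 3"
    by (rule four_sum_le_below) auto
  ultimately show ?thesis
    using four_sum_split[OF assms(1), of n] four_sum_split[OF assms(2), of n] four_sum_nonneg[of "A \<inter> {..<n}"]
    by (simp add: field_simps)
qed

text \<open>
  Base four leaves so much room between digits that sums at distance at most half of
  \<open>4 ^ (M + 1)\<close> share all their digits from \<open>M\<close> on.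
\<close>

lemma four_sum_close_imp_agree:
  assumes fin: "finite A" "finite B" and close: "\<bar>four_sum A - four_sum B\<bar> \<le> 4 ^ (M + 1) / 2" and "M \<le> n"
  shows "n \<in> A \<longleftrightarrow> n \<in> B"
proof (rule ccontr)
  define D where "D = (A - B) \<union> (B - A)"
  assume "\<not> ?thesis"
  then have n: "n \<in> D" by (auto simp: D_def)
  have "finite D" using fin by (simp add: D_def)
  define m where "m = Max D"
  have m: "m \<in> D" "n \<le> m"
    unfolding m_def using \<open>finite D\<close> n by (auto intro: Max_in Max_ge)
  have "j \<notin> D" if "j > m" for j
    using that Max_ge[OF \<open>finite D\<close>, of j] unfolding m_def by auto
  then have above: "j \<in> A \<longleftrightarrow> j \<in> B" if "j > m" for j
    using that unfolding D_def by blast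
  have "\<bar>four_sum A - four_sum B\<bar> \<ge> (2 * 4 ^ (m + 1) + 4) / 3"
  proof (cases "m \<in> A")
    case True
    then have "m \<notin> B" using m(1) by (simp add: D_def)
    from four_sum_gap[OF fin True this above] show ?thesis by linarith
  next
    case False
    then have "m \<in> B" using m(1) by (simp add: D_def)
    from four_sum_gap[OF fin(2,1) this False above[symmetric]] show ?thesis by linarith
  qed
  moreover have "(4::real) ^ (M + 1) \<le> 4 ^ (m + 1)"
    using m \<open>M \<le> n\<close> by (intro power_increasing) auto
  moreover have False
    if "(2 * b + 4) / 3 \<le> d" "a \<le> b" "d \<le> a / 2" "0 < a" for a b d :: real
    using that by (simp add: field_simps)
  ultimately show False using close zero_less_power[of "4::real"] by (metis zero_less_numeral)
qed

lemma four_sum_close_imp_eq: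
  assumes "finite A" "finite B" "\<bar>four_sum A - four_sum B\<bar> \<le> 2"
  shows "A = B"
  using four_sum_close_imp_agree[of A B 0] assms by auto

text \<open>
  The finite sums over \<open>N\<close> form an IP set. Recurrence of the orbit comes from adding one
  more far away summand to all sums in sight.
\<close>

definition finite_sums :: "nat set \<Rightarrow> real set" where
  "finite_sums N = {four_sum A | A. finite A \<and> A \<subseteq> N}"

definition tent :: "nat set \<Rightarrow> real \<Rightarrow> real" where
  "tent N t = max 0 (1 - infdist t (finite_sums N))"

lemma finite_sums_nonempty: "finite_sums N \<noteq> {}"
  by (auto simp: finite_sums_def intro: exI[of _ "{}"])

lemma tent_nonneg: "0 \<le> tent N t" and tent_le_1: "tent N t \<le> 1"
  by (auto simp: tent_def infdist_nonneg)

lemma tent_lipschitz: "\<bar>tent N s - tent N t\<bar> \<le> \<bar>s - t\<bar>"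
  using infdist_triangle_abs[of s "finite_sums N" t] by (auto simp: tent_def dist_real_def)

text \<open>
  Sums are more than 2 apart, so the supports of the bumps are disjoint.
\<close>

lemma tent_near:
  assumes "finite A" "A \<subseteq> N" "\<bar>t - four_sum A\<bar> < 1"
  shows "tent N t = 1 - \<bar>t - four_sum A\<bar>"
proof -
  have "infdist t (finite_sums N) \<ge> \<bar>t - four_sum A\<bar>"
    unfolding infdist_notempty[OF finite_sums_nonempty]
  proof (rule cINF_greatest[OF finite_sums_nonempty])
    fix k assume "k \<in> finite_sums N"
    then obtain B where B: "finite B" "k = four_sum B" by (auto simp: finite_sums_def)
    then show "\<bar>t - four_sum A\<bar> \<le> dist t k"
    proof (cases "\<bar>four_sum A - four_sum B\<bar> \<le> 2")
      case True
      then show ?thesis using four_sum_close_imp_eq assms B by (metis dist_real_def order_refl)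
    next
      case False
      then show ?thesis
        using assms(3) B abs_triangle_ineq[of "t - four_sum B" "four_sum A - t"]
        by (simp add: dist_real_def abs_minus_commute)
    qed
  qed
  moreover have "infdist t (finite_sums N) \<le> \<bar>t - four_sum A\<bar>"
    using infdist_le[of "four_sum A" "finite_sums N" t] assms by (auto simp: finite_sums_def dist_real_def)
  ultimately show ?thesis using assms by (simp add: tent_def)
qed

lemma tent_posE:
  assumes "0 < tent N t"
  obtains A where "finite A" "A \<subseteq> N" "\<bar>t - four_sum A\<bar> < 1" "tent N t = 1 - \<bar>t - four_sum A\<bar>"
proof -
  have "infdist t (finite_sums N) < 1" using assms by (simp add: tent_def split: if_splits)
  then obtain k where "k \<in> finite_sums N" "dist t k < 1"
    unfolding infdist_notempty[OF finite_sums_nonempty] by (subst (asm) cINF_less_iff) (auto simp: finite_sums_nonempty)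
  then show thesis using that tent_near by (auto simp: finite_sums_def dist_real_def)
qed

lemma tent_mono:
  assumes "N \<subseteq> N'"
  shows "tent N t \<le> tent N' t"
proof (cases "0 < tent N t")
  case True
  then obtain A where "finite A" "A \<subseteq> N" "\<bar>t - four_sum A\<bar> < 1" "tent N t = 1 - \<bar>t - four_sum A\<bar>"
    by (rule tent_posE)
  then show ?thesis using tent_near[of A N' t] assms by simp
next
  case False
  then show ?thesis using tent_nonneg[of N' t] by linarith
qed

text \<open>
  The function \<open>tent N\<close> at \<open>t\<close> depends only on the finite sums in the unit
  neighbourhood of \<open>t\<close>.
\<close>

lemma tent_cong:
  assumes "\<And>A. finite A \<Longrightarrow> A \<subseteq> N \<Longrightarrow> \<bar>t - four_sum A\<bar> < 1 \<Longrightarrow>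
               \<exists>B. finite B \<and> B \<subseteq> N' \<and> t' - four_sum B = t - four_sum A"
    and "\<And>B. finite B \<Longrightarrow> B \<subseteq> N' \<Longrightarrow> \<bar>t' - four_sum B\<bar> < 1 \<Longrightarrow>
               \<exists>A. finite A \<and> A \<subseteq> N \<and> t - four_sum A = t' - four_sum B"
  shows "tent N t = tent N' t'"
proof (cases "0 < tent N t \<or> 0 < tent N' t'")
  case True
  then show ?thesis
  proof
    assume "0 < tent N t"
    then obtain A where A: "finite A" "A \<subseteq> N" "\<bar>t - four_sum A\<bar> < 1" "tent N t = 1 - \<bar>t - four_sum A\<bar>"
      by (rule tent_posE)
    from assms(1)[OF A(1-3)] obtain B where "finite B" "B \<subseteq> N'" "t' - four_sum B = t - four_sum A"
      by blast
    with A show ?thesis using tent_near[of B N' t'] by simp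
  next
    assume "0 < tent N' t'"
    then obtain B where B: "finite B" "B \<subseteq> N'" "\<bar>t' - four_sum B\<bar> < 1" "tent N' t' = 1 - \<bar>t' - four_sum B\<bar>"
      by (rule tent_posE)
    from assms(2)[OF B(1-3)] obtain A where "finite A" "A \<subseteq> N" "t - four_sum A = t' - four_sum B"
      by blast
    with B show ?thesis using tent_near[of A N t] by simp
  qed
next
  case False
  then show ?thesis using tent_nonneg[of N t] tent_nonneg[of N' t'] by linarith
qed

text \<open>
  Near 0 only digits below \<open>M\<close> occur, and a set \<open>A\<close> of digits from \<open>M\<close> on can be added to
  them without a carry. The condition \<open>A \<subseteq> N\<close> keeps the new sums inside \<open>N\<close>.
\<close>

lemma tent_shift:
  assumes A: "finite A" "A \<subseteq> N" "A \<subseteq> {M..}" and t: "\<bar>t\<bar> \<le> 4 ^ (M + 1) / 2 - 1"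
  shows "tent N (t + four_sum A) = tent N t"
proof (rule tent_cong[symmetric])
  fix B assume B: "finite B" "B \<subseteq> N" "\<bar>t - four_sum B\<bar> < 1"
  have "\<bar>four_sum B - four_sum {}\<bar> \<le> 4 ^ (M + 1) / 2" unfolding four_sum_empty using B t by linarith
  then have "B \<inter> {M..} = {}" using four_sum_close_imp_agree[of B "{}" M] B by auto
  then have "four_sum (B \<union> A) = four_sum B + four_sum A" using A B by (intro four_sum_Un_disjoint) auto
  then show "\<exists>C. finite C \<and> C \<subseteq> N \<and> t + four_sum A - four_sum C = t - four_sum B"
    using A B by (intro exI[of _ "B \<union> A"]) auto
next
  fix B assume B: "finite B" "B \<subseteq> N" "\<bar>t + four_sum A - four_sum B\<bar> < 1"
  have "\<bar>four_sum A - four_sum B\<bar> \<le> 4 ^ (M + 1) / 2" using B t by linarith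
  then have "A \<subseteq> B" using four_sum_close_imp_agree[of A B M] A B by fastforce
  then have "four_sum B = four_sum (B - A) + four_sum A"
    using A B four_sum_Un_disjoint[of "B - A" A] by (simp add: Un_absorb2 Int_commute)
  then show "\<exists>C. finite C \<and> C \<subseteq> N \<and> t - four_sum C = t + four_sum A - four_sum B"
    using B by (intro exI[of _ "B - A"]) auto
qed

text \<open>
  With the digits from \<open>M\<close> on fixed, the sums fill less than a third of a period \<open>12 * Q\<close>.
  If a window around \<open>s\<close> meets such a block, then moving it left by \<open>5 * Q\<close> takes it past the
  beginning of the block without reaching the preceding one.
\<close>

lemma tent_gaps:
  assumes Q: "12 * Q = 4 ^ (M + 1)" and R: "2 * R + 2 \<le> Q"
  shows "(\<forall>q. \<bar>q\<bar> \<le> R \<longrightarrow> tent UNIV (s + q) = 0) \<or>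
         (\<forall>q. \<bar>q\<bar> \<le> R \<longrightarrow> tent UNIV (s + (q - 5 * Q)) = 0)"
proof -
  have False
    if p: "\<bar>p\<bar> \<le> R" "tent UNIV (s + p) \<noteq> 0"
      and q: "\<bar>q\<bar> \<le> R" "tent UNIV (s + (q - 5 * Q)) \<noteq> 0" for p q
  proof -
    have "0 < tent UNIV (s + p)" using p(2) tent_nonneg[of UNIV "s + p"] by linarith
    then obtain A where A: "finite A" "\<bar>s + p - four_sum A\<bar> < 1" by (rule tent_posE)
    have "0 < tent UNIV (s + (q - 5 * Q))"
      using q(2) tent_nonneg[of UNIV "s + (q - 5 * Q)"] by linarith
    then obtain B where B: "finite B" "\<bar>s + (q - 5 * Q) - four_sum B\<bar> < 1" by (rule tent_posE)
    have near: "\<bar>four_sum A - four_sum B - 5 * Q\<bar> < Q"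
      using A(2) B(2) p(1) q(1) R by linarith
    then have "\<bar>four_sum A - four_sum B\<bar> \<le> 12 * Q / 2" by linarith
    then have "A \<inter> {M..} = B \<inter> {M..}"
      using four_sum_close_imp_agree[of A B M] A B unfolding Q by auto
    then have "four_sum (A \<inter> {M..}) = four_sum (B \<inter> {M..})" by simp
    then have "four_sum A - four_sum B \<le> four_sum (A \<inter> {..<M})"
      using four_sum_split[OF A(1), of M] four_sum_split[OF B(1), of M] four_sum_nonneg[of "B \<inter> {..<M}"]
      by linarith
    also have "\<dots> \<le> (12 * Q - 4) / 3" unfolding Q by (rule four_sum_le_below) auto
    finally show False using near by (simp add: field_simps)
  qed
  then show ?thesis by meson
qed

section \<open>A filter without pseudo-intersection\<close>

text \<open>
  The filter product of the cofinite filter with itself, carried over from pairs to numbers by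
  \<open>prod_encode\<close>. Two properties matter: finitely many of its members always have infinitely many
  elements in common, but no infinite set is almost contained in all of them.
\<close>

definition large :: "nat set set" where
  "large = {N. \<forall>\<^sub>F i in sequentially. \<forall>\<^sub>F j in sequentially. prod_encode (i, j) \<in> N}"

lemma large_UNIV: "UNIV \<in> large"
  by (simp add: large_def)

lemma large_Int: "N \<in> large \<Longrightarrow> N' \<in> large \<Longrightarrow> N \<inter> N' \<in> large"
  by (simp add: large_def eventually_conj_iff)

lemma large_Inter: "finite F \<Longrightarrow> F \<subseteq> large \<Longrightarrow> \<Inter>F \<in> large"
  by (induction F rule: finite_induct) (auto simp: large_UNIV large_Int)

lemma large_cofinite:
  assumes "finite (- N)"
  shows "N \<in> large"
proof -
  obtain b where b: "\<And>n. n \<in> - N \<Longrightarrow> n \<le> b"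
    using assms unfolding finite_nat_set_iff_bounded_le by auto
  have "prod_encode (i, j) \<in> N" if "i > b" for i j
  proof (rule ccontr)
    assume "prod_encode (i, j) \<notin> N"
    then have "prod_encode (i, j) \<le> b" using b by blast
    then show False using le_prod_encode_1[of i j] that by linarith
  qed
  then show ?thesis
    unfolding large_def eventually_sequentially
    by (intro CollectI exI[of _ "Suc b"] allI impI) auto
qed

lemma large_Int_atLeast: "N \<in> large \<Longrightarrow> N \<inter> {M..} \<in> large"
  using large_Int[OF _ large_cofinite[of "{M..}"]] by (simp add: Compl_atLeast)

lemma large_unbounded:
  assumes "N \<in> large"
  shows "\<exists>n\<in>N. M \<le> n"
proof -
  have "{} \<notin> large" by (simp add: large_def)
  then have "N \<inter> {M..} \<noteq> {}"
    using large_Int_atLeast[OF assms, of M] by metis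
  then show ?thesis by auto
qed

text \<open>
  An infinite set of pairs either has an infinite column, and then the complement of that column
  is in the filter, or all its columns are finite, and then its own complement is in the filter.
\<close>

lemma large_no_pseudo_intersection:
  assumes "infinite A"
  obtains N where "N \<in> large" "infinite (A - N)"
proof (cases "\<exists>i. infinite {j. prod_encode (i, j) \<in> A}")
  case True
  then obtain i where i: "infinite {j. prod_encode (i, j) \<in> A}" by blast
  define N where "N = {n. fst (prod_decode n) \<noteq> i}"
  have "N \<in> large"
    unfolding large_def N_def eventually_sequentially
    by (intro CollectI exI[of _ "Suc i"] allI impI) auto
  have "inj_on (\<lambda>j. prod_encode (i, j)) {j. prod_encode (i, j) \<in> A}"
    by (auto intro: inj_onI)
  then have "infinite ((\<lambda>j. prod_encode (i, j)) ` {j. prod_encode (i, j) \<in> A})"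
    using i finite_image_iff by blast
  moreover have "(\<lambda>j. prod_encode (i, j)) ` {j. prod_encode (i, j) \<in> A} \<subseteq> A - N"
    by (auto simp: N_def)
  ultimately have "infinite (A - N)"
    using finite_subset by blast
  with \<open>N \<in> large\<close> show thesis by (rule that)
next
  case False
  \<comment> \<open>every column of \<open>A\<close> is finite\<close>
  then have "- A \<in> large"
    unfolding large_def cofinite_eq_sequentially[symmetric] by (simp add: eventually_cofinite)
  moreover have "A - - A = A" by auto
  ultimately show thesis using that[of "- A"] assms by simp
qed

section \<open>Products of lines\<close>

lemma open_coordinates_near:
  fixes x :: "'a \<Rightarrow> real"
  assumes "finite J"
  shows "open {y. \<forall>i\<in>J. \<bar>y i - x i\<bar> < d}"
proof -
  have "open (\<Inter>i\<in>J. {y. \<bar>y i - x i\<bar> < d})"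
    using assms by (intro open_INT ballI open_Collect_less continuous_intros continuous_on_product_coordinates)
  moreover have "(\<Inter>i\<in>J. {y. \<bar>y i - x i\<bar> < d}) = {y. \<forall>i\<in>J. \<bar>y i - x i\<bar> < d}" by auto
  ultimately show ?thesis by simp
qed

lemma closure_coordinates_near:
  fixes x :: "'a \<Rightarrow> real"
  assumes "x \<in> closure S" "finite J" "0 < d"
  obtains y where "y \<in> S" "\<And>i. i \<in> J \<Longrightarrow> \<bar>y i - x i\<bar> < d"
proof -
  have "x \<in> {y. \<forall>i\<in>J. \<bar>y i - x i\<bar> < d}" using assms by simp
  then have "{y. \<forall>i\<in>J. \<bar>y i - x i\<bar> < d} \<inter> S \<noteq> {}"
    using open_coordinates_near[OF assms(2)] assms(1) open_Int_closure_eq_empty by blast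
  then show thesis using that by blast
qed

lemma open_coordinates_nearE:
  fixes x :: "'a \<Rightarrow> real"
  assumes "open U" "x \<in> U"
  obtains J d where "finite J" "0 < d" "\<And>y. (\<And>i. i \<in> J \<Longrightarrow> \<bar>y i - x i\<bar> < d) \<Longrightarrow> y \<in> U"
proof -
  have "openin (product_topology (\<lambda>i. euclidean) UNIV) U"
    using assms by (simp add: euclidean_product_topology)
  from product_topology_open_contains_basis[OF this \<open>x \<in> U\<close>]
  obtain V where V: "x \<in> Pi\<^sub>E UNIV V" "\<And>i. open (V i)" "finite {i. V i \<noteq> UNIV}" "Pi\<^sub>E UNIV V \<subseteq> U"
    by auto
  define J where "J = {i. V i \<noteq> UNIV}"
  have "\<exists>e>0. ball (x i) e \<subseteq> V i" for i
    using V(1,2) open_contains_ball by (metis PiE_mem UNIV_I)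
  then obtain e where e: "\<And>i. 0 < e i" "\<And>i. ball (x i) (e i) \<subseteq> V i" by metis
  define d where "d = Min (insert 1 (e ` J))"
  have d: "0 < d" "\<And>i. i \<in> J \<Longrightarrow> d \<le> e i"
    using V(3) e(1) by (auto simp: d_def J_def)
  have "y \<in> U" if y: "\<And>i. i \<in> J \<Longrightarrow> \<bar>y i - x i\<bar> < d" for y
  proof -
    have "y i \<in> V i" for i
    proof (cases "i \<in> J")
      case True
      then have "y i \<in> ball (x i) (e i)"
        using y[OF True] d(2)[OF True] by (simp add: dist_real_def abs_minus_commute)
      then show ?thesis using e(2) by blast
    qed (simp add: J_def)
    then show ?thesis using V(4) by auto
  qed
  then show thesis using that[of J d] V(3) d(1) by (auto simp: J_def)
qed

section \<open>The orbit closure\<close>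

text \<open>
  The curve records, in the row \<open>N\<close>, all translates of \<open>tent N\<close>. The real coordinate makes
  translation act on the closure of the orbit. Rows outside the filter are put to 0 so that the
  index set is a whole type.
\<close>

definition curve :: "real \<Rightarrow> nat set \<times> real \<Rightarrow> real" where
  "curve s = (\<lambda>(N, r). if N \<in> large then tent N (s + r) else 0)"

definition orbit_closure :: "(nat set \<times> real \<Rightarrow> real) set" where
  "orbit_closure = closure (range curve)"

definition flow :: "real \<Rightarrow> (nat set \<times> real \<Rightarrow> real) \<Rightarrow> nat set \<times> real \<Rightarrow> real" where
  "flow t x = (\<lambda>(N, r). x (N, r + t))"

lemma flow_apply [simp]: "flow t x (N, r) = x (N, r + t)"
  by (simp add: flow_def)

lemma flow_0 [simp]: "flow 0 x = x"
  by (simp add: flow_def)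

lemma flow_curve: "flow t (curve s) = curve (s + t)"
proof (rule ext)
  fix i :: "nat set \<times> real"
  have "s + (snd i + t) = s + t + snd i" by simp
  then show "flow t (curve s) i = curve (s + t) i"
    by (simp only: flow_def curve_def split_beta fst_conv snd_conv)
qed

lemma curve_in_orbit_closure: "curve s \<in> orbit_closure"
  unfolding orbit_closure_def by (rule subsetD[OF closure_subset]) simp

lemma orbit_closure_approx:
  assumes "x \<in> orbit_closure" "finite J" "0 < d"
  obtains s where "\<And>i. i \<in> J \<Longrightarrow> \<bar>curve s i - x i\<bar> < d"
proof -
  obtain y where "y \<in> range curve" "\<And>i. i \<in> J \<Longrightarrow> \<bar>y i - x i\<bar> < d"
    using closure_coordinates_near[OF assms(1)[unfolded orbit_closure_def] assms(2,3)] by metis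
  then show thesis using that by blast
qed

text \<open>
  Weak inequalities between coordinates pass from the curve to its closure in this way.
\<close>

lemma orbit_closure_subset: "closed C \<Longrightarrow> (\<And>s. curve s \<in> C) \<Longrightarrow> orbit_closure \<subseteq> C"
  unfolding orbit_closure_def by (intro closure_minimal) auto

lemma curve_lipschitz: "\<bar>curve s i - curve t i\<bar> \<le> \<bar>s - t\<bar>"
  using tent_lipschitz[of "fst i" "s + snd i" "t + snd i"] by (simp add: curve_def split_beta)

lemma continuous_on_curve: "continuous_on S curve"
proof (rule continuous_on_coordinatewise_then_product)
  fix i
  show "continuous_on S (\<lambda>s. curve s i)"
  proof (rule continuous_on_subset[OF lipschitz_on_continuous_on subset_UNIV])
    show "1-lipschitz_on UNIV (\<lambda>s. curve s i)"
      by (rule lipschitz_onI) (auto simp: dist_real_def curve_lipschitz)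
  qed
qed

lemma continuous_on_flow: "continuous_on S (flow t)"
  by (intro continuous_on_coordinatewise_then_product)
     (auto simp: flow_def split: prod.split intro!: continuous_on_subset[OF continuous_on_product_coordinates])

lemma orbit_closure_lipschitz:
  assumes "x \<in> orbit_closure"
  shows "\<bar>x (N, q) - x (N, r)\<bar> \<le> \<bar>q - r\<bar>"
proof -
  have "orbit_closure \<subseteq> {x. \<bar>x (N, q) - x (N, r)\<bar> \<le> \<bar>q - r\<bar>}"
  proof (rule orbit_closure_subset)
    show "curve s \<in> {x. \<bar>x (N, q) - x (N, r)\<bar> \<le> \<bar>q - r\<bar>}" for s
      using tent_lipschitz[of N "s + q" "s + r"] by (auto simp: curve_def)
  qed (intro closed_Collect_le continuous_intros continuous_on_product_coordinates)
  then show ?thesis using assms by blast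
qed

lemma orbit_closure_bounds:
  assumes "x \<in> orbit_closure"
  shows "0 \<le> x (N, q)" "x (N, q) \<le> x (UNIV, q)" "x (N, q) \<le> 1"
proof -
  have "orbit_closure \<subseteq> {x. 0 \<le> x (N, q)}"
    by (rule orbit_closure_subset)
      (auto simp: curve_def tent_nonneg intro!: closed_Collect_le continuous_intros continuous_on_product_coordinates)
  moreover have "orbit_closure \<subseteq> {x. x (N, q) \<le> x (UNIV, q)}"
    by (rule orbit_closure_subset)
      (auto simp: curve_def tent_nonneg tent_mono large_UNIV intro!: closed_Collect_le continuous_intros continuous_on_product_coordinates)
  moreover have "orbit_closure \<subseteq> {x. x (N, q) \<le> 1}"
    by (rule orbit_closure_subset)
      (auto simp: curve_def tent_le_1 intro!: closed_Collect_le continuous_intros continuous_on_product_coordinates)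
  ultimately show "0 \<le> x (N, q)" "x (N, q) \<le> x (UNIV, q)" "x (N, q) \<le> 1" using assms by blast+
qed

lemma flow_in_orbit_closure:
  assumes "x \<in> orbit_closure"
  shows "flow t x \<in> orbit_closure"
proof -
  have "flow t ` orbit_closure \<subseteq> closure (flow t ` range curve)"
    unfolding orbit_closure_def by (rule image_closure_subset[OF continuous_on_flow closed_closure closure_subset])
  also have "\<dots> \<subseteq> orbit_closure"
    unfolding orbit_closure_def by (intro closure_mono) (auto simp: flow_curve)
  finally show ?thesis using assms by blast
qed

lemma compact_orbit_closure: "compact orbit_closure"
proof -
  have "compactin (product_topology (\<lambda>i. euclidean) UNIV) (Pi\<^sub>E UNIV (\<lambda>i::nat set \<times> real. {0..1::real}))"
    by (subst compactin_PiE) auto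
  then have "compact (Pi\<^sub>E UNIV (\<lambda>i::nat set \<times> real. {0..1::real}))"
    by (simp add: euclidean_product_topology)
  moreover have "orbit_closure \<subseteq> Pi\<^sub>E UNIV (\<lambda>i::nat set \<times> real. {0..1::real})"
    using orbit_closure_bounds(1,3) by auto
  moreover have "closed orbit_closure" by (simp add: orbit_closure_def)
  ultimately show ?thesis by (metis compact_Int_closed inf.absorb_iff2)
qed

lemma connected_orbit_closure: "connected orbit_closure"
  unfolding orbit_closure_def
  by (intro connected_imp_connected_closure connected_continuous_image continuous_on_curve connected_UNIV)

definition common :: "(nat set \<times> real) set \<Rightarrow> nat set" where
  "common J = \<Inter>(fst ` J \<inter> large)"

lemma common_large: "finite J \<Longrightarrow> common J \<in> large"
  unfolding common_def by (intro large_Inter) auto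

lemma ex_power_four_ge: "\<exists>M. (K::real) \<le> 4 ^ M"
  using real_arch_pow[of 4 K] by (auto intro: less_imp_le)

text \<open>
  Finitely many coordinates cannot distinguish \<open>t\<close> from its translate by \<open>four_sum A\<close>, provided
  that \<open>A\<close> is far out and contained in all rows concerned. The filter supplies such \<open>A\<close>.
\<close>

lemma curve_recurrent:
  assumes "finite J"
  obtains M where "\<And>A i. \<lbrakk>finite A; A \<subseteq> common J; A \<subseteq> {M..}; i \<in> J\<rbrakk> \<Longrightarrow> curve (t + four_sum A) i = curve t i"
proof -
  define K where "K = (\<Sum>i\<in>J. \<bar>t + snd i\<bar>)"
  have K: "\<bar>t + snd i\<bar> \<le> K" if "i \<in> J" for i
    unfolding K_def using assms that by (intro member_le_sum) auto
  obtain M where "(K + 1) / 2 \<le> 4 ^ M" using ex_power_four_ge by blast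
  then have M: "K \<le> 4 ^ (M + 1) / 2 - 1" by simp
  have "curve (t + four_sum A) i = curve t i"
    if A: "finite A" "A \<subseteq> common J" "A \<subseteq> {M..}" and "i \<in> J" for A i
  proof (cases i)
    case (Pair N r)
    have "tent N ((t + r) + four_sum A) = tent N (t + r)" if "N \<in> large"
    proof (rule tent_shift)
      show "A \<subseteq> N" using A(2) that \<open>i \<in> J\<close> Pair unfolding common_def by force
      show "\<bar>t + r\<bar> \<le> 4 ^ (M + 1) / 2 - 1" using K[OF \<open>i \<in> J\<close>] M Pair by simp
    qed (use A in auto)
    moreover have "t + four_sum A + r = (t + r) + four_sum A" by simp
    ultimately show ?thesis by (simp only: curve_def Pair prod.case) simp
  qed
  then show thesis by (rule that)
qed

section \<open>Indecomposability\<close>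

text \<open>
  A finite set of translates turns the bumps of a row into plateaus. The endpoints of the interval
  have to belong to the net, as they determine where a plateau ends.
\<close>

lemma half_unit_net:
  fixes a b :: real
  assumes "a \<le> b"
  obtains P where "finite P" "P \<subseteq> {a..b}" "a \<in> P" "b \<in> P"
    "\<And>w. a \<le> w \<Longrightarrow> w \<le> b \<Longrightarrow> \<exists>p\<in>P. \<bar>w - p\<bar> \<le> 1 / 2"
proof -
  define f where "f = (\<lambda>j::nat. a + real j / 2)"
  define n where "n = nat \<lfloor>2 * (b - a)\<rfloor>"
  have n: "real n \<le> 2 * (b - a)" using assms by (simp add: n_def)
  show thesis
  proof (rule that[of "insert b (f ` {..n})"])
    show "insert b (f ` {..n}) \<subseteq> {a..b}"
    proof -
      have "f j \<le> b" if "j \<le> n" for j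
        using that n by (simp add: f_def field_simps)
      then show ?thesis using assms by (auto simp: f_def)
    qed
    show "a \<in> insert b (f ` {..n})" by (auto simp: f_def image_iff intro!: bexI[of _ 0])
    fix w assume w: "a \<le> w" "w \<le> b"
    define j where "j = nat \<lfloor>2 * (w - a)\<rfloor>"
    have "j \<le> n" unfolding j_def n_def using w by (intro nat_mono floor_mono) simp
    moreover have "real j \<le> 2 * (w - a)" "2 * (w - a) < real j + 1"
      using w by (simp_all add: j_def)
    then have "\<bar>w - f j\<bar> \<le> 1 / 2" unfolding f_def by (simp add: abs_le_iff field_simps)
    ultimately show "\<exists>p\<in>insert b (f ` {..n}). \<bar>w - p\<bar> \<le> 1 / 2" by auto
  qed auto
qed

lemma large_arbitrarily_large:
  assumes "N \<in> large"
  obtains n where "n \<in> N" "M \<le> n" "K < (4::real) ^ (n + 1)"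
proof -
  obtain k where k: "K < (4::real) ^ k" using real_arch_pow[of 4 K] by auto
  obtain n where n: "n \<in> N" "max M k \<le> n" using large_unbounded[OF assms] by blast
  have "(4::real) ^ k \<le> 4 ^ (n + 1)" using n by (intro power_increasing) auto
  with k n show thesis using that[of n] by auto
qed

text \<open>
  Suppose that \<open>C\<close> misses \<open>curve u\<close>. Take \<open>m\<close> and, much further out, a tail \<open>N'\<close> of the common
  part of the rows concerned. A finite maximum of coordinates in the row \<open>N'\<close> detects whether a
  parameter lies in a block, that is, between \<open>u + k\<close> and \<open>u + k + 4 ^ (m + 1)\<close> for a finite
  sum \<open>k\<close> over \<open>N'\<close>. By recurrence the ends of all blocks look like \<open>curve u\<close>, so they stay
  away from \<open>C\<close>, and the blocks cut \<open>C\<close> into two closed pieces. Again by recurrence, the curve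
  passes through the interior of \<open>C\<close> both inside and outside the blocks, so neither piece is empty.
\<close>

lemma connected_with_interior_contains_curve:
  assumes C: "closed C" "connected C" "C \<subseteq> orbit_closure"
    and U: "open U" "curve v \<in> U" "\<And>s. curve s \<in> U \<Longrightarrow> curve s \<in> C"
  shows "curve u \<in> C"
proof (rule ccontr)
  assume "curve u \<notin> C"
  then obtain J1 d where J1: "finite J1" "0 < d"
      "\<And>y. (\<And>i. i \<in> J1 \<Longrightarrow> \<bar>y i - curve u i\<bar> < d) \<Longrightarrow> y \<in> - C"
    using open_coordinates_nearE[of "- C" "curve u"] C(1) by (metis ComplI open_Compl)
  obtain J2 d' where J2: "finite J2" "0 < d'"
      "\<And>y. (\<And>i. i \<in> J2 \<Longrightarrow> \<bar>y i - curve v i\<bar> < d') \<Longrightarrow> y \<in> U"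
    using open_coordinates_nearE[OF U(1,2)] by metis
  define N where "N = common (J1 \<union> J2)"
  have fin: "finite (J1 \<union> J2)" using J1 J2 by simp
  have N: "N \<in> large" unfolding N_def by (rule common_large[OF fin])
  obtain M1 where M1: "\<And>A i. \<lbrakk>finite A; A \<subseteq> N; A \<subseteq> {M1..}; i \<in> J1 \<union> J2\<rbrakk>
      \<Longrightarrow> curve (u + four_sum A) i = curve u i"
    using curve_recurrent[OF fin, of u] unfolding N_def by metis
  obtain M2 where M2: "\<And>A i. \<lbrakk>finite A; A \<subseteq> N; A \<subseteq> {M2..}; i \<in> J1 \<union> J2\<rbrakk>
      \<Longrightarrow> curve (v + four_sum A) i = curve v i"
    using curve_recurrent[OF fin, of v] unfolding N_def by metis
  have inC: "curve (v + 4 ^ (n + 1)) \<in> C" if "n \<in> N" "M2 \<le> n" for n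
  proof (intro U(3) J2(3))
    fix i assume "i \<in> J2"
    then show "\<bar>curve (v + 4 ^ (n + 1)) i - curve v i\<bar> < d'"
      using M2[of "{n}" i] that J2(2) by simp
  qed
  obtain n1 where n1: "n1 \<in> N" "M2 \<le> n1" "u - v < 4 ^ (n1 + 1)"
    by (rule large_arbitrarily_large[OF N])
  define s1 where "s1 = v + 4 ^ (n1 + 1)"
  have s1: "curve s1 \<in> C" "u < s1" using inC n1 by (simp_all add: s1_def)
  obtain m where m: "m \<in> N" "M1 \<le> m" "max 2 (s1 - u) < 4 ^ (m + 1)"
    by (rule large_arbitrarily_large[OF N])
  define L :: real where "L = 4 ^ (m + 1)"
  have L: "2 < L" "s1 < u + L" using m by (auto simp: L_def)
  obtain n2 where n2: "n2 \<in> N" "M2 \<le> n2" "u + L - v < 4 ^ (n2 + 1)"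
    by (rule large_arbitrarily_large[OF N])
  define s2 where "s2 = v + 4 ^ (n2 + 1)"
  have s2: "curve s2 \<in> C" "u + L < s2" using inC n2 by (simp_all add: s2_def)
  obtain M where M: "max M1 (m + 1) \<le> M" "s2 - u < 4 ^ (M + 1)"
    by (rule large_arbitrarily_large[OF large_UNIV])
  define N' where "N' = N \<inter> {M..}"
  have N': "N' \<in> large" unfolding N'_def by (rule large_Int_atLeast[OF N])
  obtain P where P: "finite P" "P \<subseteq> {3/4..L - 3/4}" "3/4 \<in> P" "L - 3/4 \<in> P"
      "\<And>w. 3/4 \<le> w \<Longrightarrow> w \<le> L - 3/4 \<Longrightarrow> \<exists>p\<in>P. \<bar>w - p\<bar> \<le> 1 / 2"
    using half_unit_net[of "3/4" "L - 3/4"] L by (auto simp: field_simps)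
  have Pb: "3/4 \<le> p" "p \<le> L - 3/4" if "p \<in> P" for p
    using P(2) that by auto
  have eval: "curve s (N', - u - p) = tent N' (s - u - p)" for s p
  proof -
    have "s + (- u - p) = s - u - p" by simp
    then show ?thesis by (simp only: curve_def prod.case N' if_True)
  qed
  \<comment> \<open>Inside a block some coordinate is above 1/4, outside none is. A tent has the value 1/4 at
     distance 3/4 from its peak, hence the margins 3/4 in the choice of \<open>P\<close>.\<close>
  define Y1 where "Y1 = (\<Union>p\<in>P. {y. (1/4::real) \<le> y (N', - u - p)})"
  define Y2 where "Y2 = (\<Inter>p\<in>P. {y. y (N', - u - p) \<le> (1/4::real)})"
  have closed1: "closed Y1" unfolding Y1_def
    by (intro closed_UN P ballI closed_Collect_le continuous_intros continuous_on_product_coordinates)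
  have closed2: "closed Y2" unfolding Y2_def
    by (intro closed_INT ballI closed_Collect_le continuous_intros continuous_on_product_coordinates)
  have cover: "C \<subseteq> Y1 \<union> Y2" by (auto simp: Y1_def Y2_def)
  have in1: "curve s1 \<in> Y1"
  proof -
    define w where "w = s1 - u"
    have w: "0 < w" "w < L" using s1 L by (simp_all add: w_def)
    have "\<exists>p\<in>P. \<bar>w - p\<bar> < 3/4"
    proof (cases "w < 3/4 \<or> w > L - 3/4")
      case True
      then have "\<bar>w - 3/4\<bar> < 3/4 \<or> \<bar>w - (L - 3/4)\<bar> < 3/4" using w by auto
      then show ?thesis using P(3,4) by blast
    next
      case False
      then obtain p where "p \<in> P" "\<bar>w - p\<bar> \<le> 1/2" using P(5)[of w] by auto
      then show ?thesis by (intro bexI[of _ p]) auto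
    qed
    then obtain p where p: "p \<in> P" "\<bar>w - p\<bar> < 3/4" by blast
    then have "tent N' (s1 - u - p) = 1 - \<bar>w - p\<bar>"
      using tent_near[of "{}" N' "s1 - u - p"] by (simp add: w_def)
    then show ?thesis using p by (auto simp: Y1_def eval intro!: bexI[of _ p])
  qed
  have in2: "curve s2 \<in> Y2"
  proof -
    have "tent N' (s2 - u - p) \<le> 1/4" if "p \<in> P" for p
    proof (rule ccontr)
      assume *: "\<not> ?thesis"
      then have "0 < tent N' (s2 - u - p)" by simp
      then obtain A where A: "finite A" "A \<subseteq> N'" "tent N' (s2 - u - p) = 1 - \<bar>s2 - u - p - four_sum A\<bar>"
        by (rule tent_posE)
      have near: "\<bar>s2 - u - p - four_sum A\<bar> < 3/4" using A(3) * by linarith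
      show False
      proof (cases "A = {}")
        case True
        then show False using near Pb[OF that] s2(2) by simp
      next
        case False
        then obtain n where "n \<in> A" by blast
        then have "M \<le> n" using A(2) by (auto simp: N'_def)
        then have "(4::real) ^ (M + 1) \<le> 4 ^ (n + 1)" by (intro power_increasing) auto
        also have "\<dots> \<le> four_sum A" by (rule four_sum_ge_power[OF A(1) \<open>n \<in> A\<close>])
        finally show False using near M(2) Pb[OF that] by linarith
      qed
    qed
    then show ?thesis by (simp add: Y2_def eval)
  qed
  have "Y1 \<inter> Y2 \<inter> C \<noteq> {}"
  proof
    assume "Y1 \<inter> Y2 \<inter> C = {}"
    moreover have "Y1 \<inter> C \<noteq> {}" "Y2 \<inter> C \<noteq> {}" using in1 in2 s1(1) s2(1) by auto
    ultimately show False
      using C(2) closed1 closed2 cover unfolding connected_closed by metis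
  qed
  then obtain y where y: "y \<in> C" "y \<in> Y1" "y \<in> Y2" by auto
  define \<delta> where "\<delta> = min (d / 2) (1/8)"
  have \<delta>: "0 < \<delta>" "\<delta> \<le> d / 2" "\<delta> \<le> 1/8" using J1(2) by (auto simp: \<delta>_def)
  have "finite (J1 \<union> (\<lambda>p. (N', - u - p)) ` P)" using J1(1) P(1) by simp
  then obtain s where s: "\<And>i. i \<in> J1 \<union> (\<lambda>p. (N', - u - p)) ` P \<Longrightarrow> \<bar>curve s i - y i\<bar> < \<delta>"
    using orbit_closure_approx[of y _ \<delta>] y(1) C(3) \<delta>(1) by (metis subsetD)
  have near_y: "\<bar>tent N' (s - u - p) - y (N', - u - p)\<bar> < \<delta>" if "p \<in> P" for p
    using s[of "(N', - u - p)"] that unfolding eval by auto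
  obtain p0 where p0: "p0 \<in> P" "1/4 \<le> y (N', - u - p0)" using y(2) by (auto simp: Y1_def)
  have t0: "1/4 - \<delta> < tent N' (s - u - p0)" using near_y[OF p0(1)] p0(2) by linarith
  then have "0 < tent N' (s - u - p0)" using \<delta> by linarith
  then obtain A where A: "finite A" "A \<subseteq> N'" "tent N' (s - u - p0) = 1 - \<bar>s - u - p0 - four_sum A\<bar>"
    by (rule tent_posE)
  define w where "w = s - u - four_sum A"
  have w0: "\<bar>w - p0\<bar> < 3/4 + \<delta>"
    using A(3) t0 unfolding w_def by linarith
  have w1: "3/4 - \<delta> < \<bar>w - p\<bar>" if "p \<in> P" for p
  proof (rule ccontr)
    assume *: "\<not> ?thesis"
    have eq: "s - u - p - four_sum A = w - p" by (simp add: w_def)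
    have "\<bar>w - p\<bar> < 1" using * \<delta> by linarith
    then have "tent N' (s - u - p) = 1 - \<bar>w - p\<bar>"
      using tent_near[OF A(1,2), of "s - u - p"] unfolding eq by blast
    moreover have "y (N', - u - p) \<le> 1/4" using y(3) that by (auto simp: Y2_def)
    ultimately show False using near_y[OF that] * by linarith
  qed
  \<comment> \<open>the ends of the blocks are recurrences of \<open>u\<close>, so \<open>y\<close> would lie near \<open>curve u\<close>\<close>
  have far: False
    if B: "finite B" "B \<subseteq> N" "B \<subseteq> {M1..}" and close: "\<bar>s - (u + four_sum B)\<bar> < \<delta>" for B
  proof -
    have "\<bar>y i - curve u i\<bar> < d" if "i \<in> J1" for i
    proof -
      have "\<bar>curve s i - curve u i\<bar> < \<delta>"
        using curve_lipschitz[of s i "u + four_sum B"] M1[OF B, of i] that close by auto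
      then show ?thesis using s[of i] that \<delta>(2) by (simp add: abs_less_iff field_simps)
    qed
    then show False using J1(3) y(1) by blast
  qed
  have AN: "A \<subseteq> N" "A \<subseteq> {M1..}" "m \<notin> A" using A(2) M(1) by (auto simp: N'_def)
  consider "w < 3/4" | "3/4 \<le> w" "w \<le> L - 3/4" | "L - 3/4 < w" by linarith
  then show False
  proof cases
    case 1
    then have "\<bar>w\<bar> < \<delta>" using w1[OF P(3)] w0 Pb[OF p0(1)] by linarith
    then have "\<bar>s - (u + four_sum A)\<bar> < \<delta>" unfolding w_def by (simp add: algebra_simps)
    then show False by (rule far[OF A(1) AN(1,2)])
  next
    case 2
    then obtain p where "p \<in> P" "\<bar>w - p\<bar> \<le> 1/2" using P(5) by blast
    then show False using w1[of p] \<delta>(3) by linarith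
  next
    case 3
    then have "\<bar>w - L\<bar> < \<delta>" using w1[OF P(4)] w0 Pb[OF p0(1)] by linarith
    moreover have "four_sum (insert m A) = four_sum A + L"
      using four_sum_Un_disjoint[of "{m}" A] A(1) AN(3) by (simp add: L_def)
    ultimately have "\<bar>s - (u + four_sum (insert m A))\<bar> < \<delta>"
      unfolding w_def by (simp add: algebra_simps)
    then show False using far[of "insert m A"] A(1) AN m by auto
  qed
qed

text \<open>
  If two closed sets covered the continuum, each of them would contain the complement of the other,
  and thus have interior points on the curve.
\<close>

lemma orbit_closure_indecomposable:
  assumes "closed C" "connected C" "C \<subseteq> orbit_closure" "C \<noteq> orbit_closure"
    and "closed D" "D \<subseteq> orbit_closure" "D \<noteq> orbit_closure"
  shows "C \<union> D \<noteq> orbit_closure"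
proof
  assume eq: "C \<union> D = orbit_closure"
  obtain u where u: "curve u \<notin> C" using assms orbit_closure_subset[of C] by blast
  obtain v where v: "curve v \<notin> D" using assms orbit_closure_subset[of D] by blast
  have "curve u \<in> C"
  proof (rule connected_with_interior_contains_curve)
    show "open (- D)" "curve v \<in> - D" using assms v by auto
    show "curve s \<in> C" if "curve s \<in> - D" for s
      using that curve_in_orbit_closure[of s] eq by blast
  qed (use assms in auto)
  then show False using u by contradiction
qed

section \<open>Backward rays\<close>

text \<open>
  The backward orbits are the subcontinua that tie all points together: each one is proper and
  accumulates at 0.
\<close>

definition backward_ray :: "(nat set \<times> real \<Rightarrow> real) \<Rightarrow> (nat set \<times> real \<Rightarrow> real) set" where
  "backward_ray x = closure ((\<lambda>t. flow t x) ` {..0})"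

lemma closed_backward_ray: "closed (backward_ray x)"
  by (simp add: backward_ray_def)

lemma mem_backward_ray: "x \<in> backward_ray x"
  unfolding backward_ray_def by (rule subsetD[OF closure_subset]) (auto simp: image_iff intro!: bexI[of _ 0])

lemma backward_ray_subset:
  assumes "x \<in> orbit_closure"
  shows "backward_ray x \<subseteq> orbit_closure"
  unfolding backward_ray_def
proof (rule closure_minimal)
  show "closed orbit_closure" by (simp add: orbit_closure_def)
qed (use flow_in_orbit_closure[OF assms] in auto)

lemma connected_backward_ray:
  assumes "x \<in> orbit_closure"
  shows "connected (backward_ray x)"
  unfolding backward_ray_def
proof (intro connected_imp_connected_closure connected_continuous_image)
  show "continuous_on {..0} (\<lambda>t. flow t x)"
  proof (rule continuous_on_coordinatewise_then_product)
    fix i :: "nat set \<times> real"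
    have "1-lipschitz_on {..0} (\<lambda>t. flow t x i)"
    proof (rule lipschitz_onI)
      show "dist (flow s x i) (flow t x i) \<le> 1 * dist s t" for s t
        using orbit_closure_lipschitz[OF assms, of "fst i" "snd i + s" "snd i + t"]
        by (simp add: flow_def split_beta dist_real_def)
    qed simp
    then show "continuous_on {..0} (\<lambda>t. flow t x i)" by (rule lipschitz_on_continuous_on)
  qed
qed simp

text \<open>
  Points of the curve have long gaps within a bounded distance to the left, with a bound that
  depends only on the length of the gap. Having one of two such gaps is a closed condition, so all
  points of the closure have gaps of every length.
\<close>

lemma zero_in_backward_ray:
  assumes "x \<in> orbit_closure"
  shows "(\<lambda>_. 0) \<in> backward_ray x"
proof (rule ccontr)
  assume "\<not> ?thesis"
  then obtain J d where J: "finite J" "0 < d"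
      "\<And>y. (\<And>i. i \<in> J \<Longrightarrow> \<bar>y i - 0\<bar> < d) \<Longrightarrow> y \<in> - backward_ray x"
    using open_coordinates_nearE[of "- backward_ray x" "\<lambda>_. 0"] closed_backward_ray
    by (metis (full_types) ComplI open_Compl)
  define R where "R = (\<Sum>i\<in>J. \<bar>snd i\<bar>)"
  have R: "\<bar>snd i\<bar> \<le> R" if "i \<in> J" for i
    unfolding R_def using J(1) that by (intro member_le_sum) auto
  obtain M where M: "6 * R + 6 \<le> 4 ^ M" using ex_power_four_ge by blast
  define Q :: real where "Q = 4 ^ (M + 1) / 12"
  have Q: "12 * Q = 4 ^ (M + 1)" "2 * R + 2 \<le> Q" using M by (simp_all add: Q_def field_simps)
  have "0 \<le> R" unfolding R_def by (rule sum_nonneg) simp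
  then have "0 \<le> Q" using Q(2) by linarith
  have hit: False if zero: "\<And>q. \<bar>q\<bar> \<le> R \<Longrightarrow> x (UNIV, q + t) = 0" and t: "t \<le> 0" for t
  proof -
    have "\<bar>flow t x i - 0\<bar> < d" if "i \<in> J" for i
      using orbit_closure_bounds[OF assms, of "fst i" "snd i + t"] zero[OF R[OF that]] J(2)
      by (simp add: flow_def split_beta)
    then have "flow t x \<in> - backward_ray x" by (rule J(3))
    moreover have "flow t x \<in> backward_ray x"
      unfolding backward_ray_def by (rule subsetD[OF closure_subset]) (use t in blast)
    ultimately show False by simp
  qed
  \<comment> \<open>\<open>Z t\<close>: a gap of length \<open>2 * R\<close> around \<open>t\<close>\<close>
  define Z where "Z = (\<lambda>t. \<Inter>q\<in>{-R..R}. {y. y (UNIV::nat set, q + t) = (0::real)})"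
  have "orbit_closure \<subseteq> Z 0 \<union> Z (- (5 * Q))"
  proof (rule orbit_closure_subset)
    show "closed (Z 0 \<union> Z (- (5 * Q)))" unfolding Z_def
      by (intro closed_Un closed_INT ballI closed_Collect_eq continuous_intros continuous_on_product_coordinates)
    fix s
    show "curve s \<in> Z 0 \<union> Z (- (5 * Q))"
      using tent_gaps[OF Q, of s] by (auto simp: Z_def curve_def large_UNIV abs_le_iff minus_le_iff)
  qed
  then have "x \<in> Z 0 \<or> x \<in> Z (- (5 * Q))" using assms by blast
  then show False
  proof
    assume "x \<in> Z 0"
    then show False by (intro hit[of 0]) (auto simp: Z_def abs_le_iff)
  next
    assume "x \<in> Z (- (5 * Q))"
    then show False using \<open>0 \<le> Q\<close> by (intro hit[of "- (5 * Q)"]) (auto simp: Z_def abs_le_iff)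
  qed
qed

lemma curve_posE:
  assumes "0 < curve s (N, q)"
  obtains A where "N \<in> large" "finite A" "A \<subseteq> N" "\<bar>s + q - four_sum A\<bar> < 1"
proof -
  have N: "N \<in> large" and "0 < tent N (s + q)"
    using assms by (simp_all add: curve_def split: if_splits)
  from this(2) obtain A where "finite A" "A \<subseteq> N" "\<bar>s + q - four_sum A\<bar> < 1" by (rule tent_posE)
  with N show thesis by (rule that)
qed

text \<open>
  Translating to the left keeps the coordinate \<open>(N, c)\<close> at 0, but the curve attains the value 1
  there.
\<close>

lemma backward_ray_proper_if_row_vanishes:
  assumes "x \<in> orbit_closure" "N \<in> large" and zero: "\<And>q. q \<le> c \<Longrightarrow> x (N, q) = 0"
  shows "backward_ray x \<noteq> orbit_closure"
proof -
  have "backward_ray x \<subseteq> {y. y (N, c) \<le> 0}"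
    unfolding backward_ray_def
  proof (rule closure_minimal)
    show "closed {y. y (N, c) \<le> (0::real)}"
      by (intro closed_Collect_le continuous_intros continuous_on_product_coordinates)
  qed (auto simp: zero)
  moreover have "curve (- c) \<notin> {y. y (N, c) \<le> 0}"
    using tent_near[of "{}" N 0] assms(2) by (simp add: curve_def)
  ultimately show ?thesis using curve_in_orbit_closure by blast
qed

text \<open>
  If \<open>x\<close> is positive at \<open>q0\<close> and \<open>curve s\<close> approximates \<open>x\<close>, then \<open>s + q0\<close> is close to a finite
  sum, and the rows \<open>- {n}\<close> tell which digits this sum has. The digits for which such a row vanishes
  are the digits of the sum in the limit: the address of \<open>x\<close> at \<open>q0\<close>. At any other position \<open>q\<close>
  the sum has the same digits from some place on, so if the row \<open>N\<close> is positive at \<open>q\<close>, then \<open>N\<close>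
  contains almost all of the address. For an infinite address some member \<open>N\<close> of the filter does
  not.
\<close>

lemma row_vanishes_if_infinite_address:
  assumes x: "x \<in> orbit_closure" and q0: "0 < x (UNIV, q0)"
    and inf: "infinite {n. x (- {n}, q0) = 0}"
  obtains N where "N \<in> large" "\<And>q. x (N, q) = 0"
proof -
  obtain N where N: "N \<in> large" "infinite ({n. x (- {n}, q0) = 0} - N)"
    using large_no_pseudo_intersection[OF inf] by blast
  have "x (N, q) = 0" for q
  proof (rule ccontr)
    assume "x (N, q) \<noteq> 0"
    then have pos: "0 < x (N, q)" using orbit_closure_bounds(1)[OF x, of N q] by simp
    obtain M where "\<bar>q - q0\<bar> + 2 \<le> 4 ^ M" using ex_power_four_ge by blast
    then have M: "\<bar>q - q0\<bar> + 2 \<le> 4 ^ (M + 1) / 2" by simp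
    obtain n where n: "x (- {n}, q0) = 0" "n \<notin> N" "M \<le> n"
      using N(2) unfolding infinite_nat_iff_unbounded_le by blast
    define d where "d = min (x (N, q)) (x (UNIV, q0)) / 2"
    have d: "0 < d" "d < x (N, q)" "d < x (UNIV, q0)" "d + d \<le> x (UNIV, q0)"
      using pos q0 by (simp_all add: d_def)
    have "finite {(N, q), (UNIV, q0), (- {n}, q0)}" by simp
    from orbit_closure_approx[OF x this d(1)] obtain s
      where s: "\<And>i. i \<in> {(N, q), (UNIV, q0), (- {n}, q0)} \<Longrightarrow> \<bar>curve s i - x i\<bar> < d"
      by metis
    have "0 < curve s (N, q)" using s[of "(N, q)"] d(2) by simp
    then obtain A where A: "finite A" "A \<subseteq> N" "\<bar>s + q - four_sum A\<bar> < 1" by (rule curve_posE)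
    have "0 < curve s (UNIV, q0)" using s[of "(UNIV, q0)"] d(3) by simp
    then obtain B where B: "finite B" "\<bar>s + q0 - four_sum B\<bar> < 1" by (rule curve_posE)
    have "\<bar>four_sum A - four_sum B\<bar> \<le> \<bar>q - q0\<bar> + 2" using A(3) B(2) by linarith
    then have "\<bar>four_sum A - four_sum B\<bar> \<le> 4 ^ (M + 1) / 2" using M by (rule order_trans)
    then have "n \<notin> B" using four_sum_close_imp_agree[OF A(1) B(1) _ n(3)] A(2) n(2) by blast
    then have "curve s (- {n}, q0) = curve s (UNIV, q0)"
      using tent_near[of B "- {n}" "s + q0"] tent_near[of B UNIV "s + q0"] B
      by (simp add: curve_def large_cofinite large_UNIV)
    then show False using s[of "(UNIV, q0)"] s[of "(- {n}, q0)"] n(1) d(4) by simp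
  qed
  with N(1) show thesis by (rule that)
qed

text \<open>
  Let \<open>A\<close> be the address. Approximating points of the curve have near \<open>q0\<close> a sum whose digits below
  any given \<open>M\<close> lie in \<open>A\<close>, so it is at most \<open>four_sum A\<close> above the beginning of the block of
  sums with the same digits from \<open>M\<close> on. Further left the row is empty, as far as the gap in front
  of that block extends, and this gap grows with \<open>M\<close>.
\<close>

lemma row_vanishes_if_finite_address:
  assumes x: "x \<in> orbit_closure" and q0: "0 < x (UNIV, q0)"
    and fin: "finite {n. x (- {n}, q0) = 0}"
  obtains c where "\<And>q. q \<le> c \<Longrightarrow> x (UNIV, q) = 0"
proof -
  define A where "A = {n. x (- {n}, q0) = 0}"
  have "x (UNIV, q) = 0" if q: "q \<le> q0 - four_sum A - 2" for q
  proof (rule ccontr)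
    assume "x (UNIV, q) \<noteq> 0"
    then have pos: "0 < x (UNIV, q)" using orbit_closure_bounds(1)[OF x, of UNIV q] by simp
    obtain M where "\<bar>q - q0\<bar> + 2 \<le> 4 ^ M" using ex_power_four_ge by blast
    then have M: "\<bar>q - q0\<bar> + 2 \<le> 4 ^ (M + 1) / 2" by simp
    \<comment> \<open>positive coordinates of \<open>x\<close>, among them those that witness that a digit below \<open>M\<close> is absent\<close>
    define J where "J = insert (UNIV, q0) (insert (UNIV, q) ((\<lambda>n. (- {n}, q0)) ` ({..<M} - A)))"
    have J: "finite J" "J \<noteq> {}" by (simp_all add: J_def)
    have "0 < x i" if "i \<in> J" for i
      using that pos q0 orbit_closure_bounds(1)[OF x] by (auto simp: J_def A_def order_less_le)
    then have d: "0 < Min (x ` J)" using J by simp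
    from orbit_closure_approx[OF x J(1) d] obtain s
      where s: "\<And>i. i \<in> J \<Longrightarrow> \<bar>curve s i - x i\<bar> < Min (x ` J)" by metis
    have s_pos: "0 < curve s i" if "i \<in> J" for i
    proof -
      have "Min (x ` J) \<le> x i" using J(1) that by simp
      then show ?thesis using s[OF that] by linarith
    qed
    have "0 < curve s (UNIV, q0)" by (rule s_pos) (simp add: J_def)
    then obtain B where B: "finite B" "\<bar>s + q0 - four_sum B\<bar> < 1" by (rule curve_posE)
    have "0 < curve s (UNIV, q)" by (rule s_pos) (simp add: J_def)
    then obtain C where C: "finite C" "\<bar>s + q - four_sum C\<bar> < 1" by (rule curve_posE)
    have "\<bar>four_sum C - four_sum B\<bar> \<le> \<bar>q - q0\<bar> + 2" using B(2) C(2) by linarith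
    then have "\<bar>four_sum C - four_sum B\<bar> \<le> 4 ^ (M + 1) / 2" using M by (rule order_trans)
    then have "C \<inter> {M..} = B \<inter> {M..}"
      using four_sum_close_imp_agree[OF C(1) B(1)] by auto
    then have high: "four_sum (C \<inter> {M..}) = four_sum (B \<inter> {M..})" by simp
    have "n \<in> A" if "n \<in> B" "n < M" for n
    proof (rule ccontr)
      assume "n \<notin> A"
      then have "0 < curve s (- {n}, q0)" using that(2) by (intro s_pos) (auto simp: J_def)
      then obtain B' where B': "finite B'" "B' \<subseteq> - {n}" "\<bar>s + q0 - four_sum B'\<bar> < 1" by (rule curve_posE)
      have "\<bar>four_sum B' - four_sum B\<bar> \<le> 2" using B'(3) B(2) by linarith
      then have "B' = B" by (rule four_sum_close_imp_eq[OF B'(1) B(1)])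
      then show False using that(1) B'(2) by blast
    qed
    then have low: "four_sum (B \<inter> {..<M}) \<le> four_sum A"
      using fin by (intro four_sum_mono) (auto simp: A_def)
    have "four_sum (C \<inter> {M..}) \<le> four_sum C" by (rule four_sum_mono[OF C(1)]) simp
    then show False
      using low high q B(2) C(2) four_sum_split[OF B(1), of M] by linarith
  qed
  then show thesis by (rule that)
qed

lemma backward_ray_proper:
  assumes "x \<in> orbit_closure"
  shows "backward_ray x \<noteq> orbit_closure"
proof (cases "\<exists>q. 0 < x (UNIV, q)")
  case True
  then obtain q0 where q0: "0 < x (UNIV, q0)" by blast
  show ?thesis
  proof (cases "finite {n. x (- {n}, q0) = 0}")
    case True
    then show ?thesis
      using row_vanishes_if_finite_address[OF assms q0]
        backward_ray_proper_if_row_vanishes[OF assms large_UNIV] by metis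
  next
    case False
    then show ?thesis
      using row_vanishes_if_infinite_address[OF assms q0]
        backward_ray_proper_if_row_vanishes[OF assms] by metis
  qed
next
  case False
  then have "x (UNIV, q) = 0" for q
    using orbit_closure_bounds(1)[OF assms, of UNIV q] by (simp add: not_less order_antisym)
  then show ?thesis by (intro backward_ray_proper_if_row_vanishes[OF assms large_UNIV, of 0])
qed

section \<open>The orbit closure is a separable Bellamy continuum\<close>

lemma Hausdorff_space_euclidean_fun: "Hausdorff_space (euclidean :: ('a \<Rightarrow> real) topology)"
  unfolding euclidean_product_topology[symmetric] by (simp add: Hausdorff_space_product_topology)

lemma continuum_space_top_of_set:
  fixes C :: "('a \<Rightarrow> real) set"
  shows "continuum_space (top_of_set C) \<longleftrightarrow> compact C \<and> connected C \<and> (\<exists>x\<in>C. \<exists>y\<in>C. x \<noteq> y)"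
  using compactin_subspace[of euclidean C] connectedin_def[of euclidean C]
    Hausdorff_space_subtopology[OF Hausdorff_space_euclidean_fun, of C]
  by (auto simp: continuum_space_def compactin_euclidean_iff connectedin_iff_connected)

lemma proper_subcontinuum_top_of_set:
  fixes S :: "('a \<Rightarrow> real) set"
  shows "proper_subcontinuum (top_of_set S) C \<longleftrightarrow>
    C \<subseteq> S \<and> C \<noteq> S \<and> compact C \<and> connected C \<and> (\<exists>x\<in>C. \<exists>y\<in>C. x \<noteq> y)"
proof (cases "C \<subseteq> S")
  case True
  then have "subtopology (top_of_set S) C = top_of_set C"
    by (simp add: subtopology_subtopology inf.absorb2)
  then show ?thesis
    using True by (auto simp: proper_subcontinuum_def subcontinuum_def continuum_space_top_of_set)
qed (simp add: proper_subcontinuum_def subcontinuum_def)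

lemma compact_imp_closed_fun:
  fixes C :: "('a \<Rightarrow> real) set"
  shows "compact C \<Longrightarrow> closed C"
  using compactin_imp_closedin[OF Hausdorff_space_euclidean_fun, of C]
  by (simp add: compactin_euclidean_iff)

lemma zero_in_orbit_closure: "(\<lambda>_. 0) \<in> orbit_closure"
  using zero_in_backward_ray backward_ray_subset curve_in_orbit_closure by blast

lemma curve_0_neq_zero: "curve 0 \<noteq> (\<lambda>_. 0)"
proof
  assume "curve 0 = (\<lambda>_. 0)"
  then have "curve 0 (UNIV, 0) = 0" by simp
  then show False using tent_near[of "{}" UNIV 0] by (simp add: curve_def large_UNIV)
qed

lemma continuum_space_orbit_closure: "continuum_space (top_of_set orbit_closure)"
  unfolding continuum_space_top_of_set
  using compact_orbit_closure connected_orbit_closure zero_in_orbit_closure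
    curve_in_orbit_closure[of 0] curve_0_neq_zero by blast

lemma indecomposable_orbit_closure: "indecomposable_continuum (top_of_set orbit_closure)"
  unfolding indecomposable_continuum_def proper_subcontinuum_top_of_set
proof (intro conjI notI continuum_space_orbit_closure; elim exE conjE)
  fix A B
  assume "compact A" "connected A" "A \<subseteq> orbit_closure" "A \<noteq> orbit_closure"
    and "compact B" "B \<subseteq> orbit_closure" "B \<noteq> orbit_closure"
    and "topspace (top_of_set orbit_closure) = A \<union> B"
  then show False using orbit_closure_indecomposable[of A B] compact_imp_closed_fun by auto
qed

text \<open>
  The rays of \<open>x\<close> and \<open>y\<close> meet in 0, and their union is proper because the continuum is
  indecomposable. The ray of \<open>curve 0\<close> is added only to have a second point in case
  \<open>x\<close> and \<open>y\<close> are both 0.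
\<close>

lemma composant_orbit_closure:
  assumes x: "x \<in> orbit_closure"
  shows "composant (top_of_set orbit_closure) x = orbit_closure"
proof
  show "composant (top_of_set orbit_closure) x \<subseteq> orbit_closure"
    by (auto simp: composant_def proper_subcontinuum_top_of_set)
  show "orbit_closure \<subseteq> composant (top_of_set orbit_closure) x"
  proof
    fix y assume y: "y \<in> orbit_closure"
    define c where "c = curve 0"
    have c: "c \<in> orbit_closure" by (simp add: c_def curve_in_orbit_closure)
    define K where "K = backward_ray x \<union> backward_ray y \<union> backward_ray c"
    have zero: "(\<lambda>_. 0) \<in> backward_ray x" "(\<lambda>_. 0) \<in> backward_ray y" "(\<lambda>_. 0) \<in> backward_ray c"
      using zero_in_backward_ray x y c by blast+
    have conn1: "connected (backward_ray x \<union> backward_ray y)"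
    proof (rule connected_Un)
      show "backward_ray x \<inter> backward_ray y \<noteq> {}" using zero by (metis IntI empty_iff)
    qed (use connected_backward_ray x y in auto)
    have "connected K" unfolding K_def
    proof (rule connected_Un[OF conn1])
      show "(backward_ray x \<union> backward_ray y) \<inter> backward_ray c \<noteq> {}"
        using zero by (metis IntI UnI1 empty_iff)
    qed (use connected_backward_ray c in auto)
    have "backward_ray x \<union> backward_ray y \<noteq> orbit_closure"
      using x y by (intro orbit_closure_indecomposable closed_backward_ray connected_backward_ray
          backward_ray_subset backward_ray_proper)
    moreover have "backward_ray x \<union> backward_ray y \<subseteq> orbit_closure"
      using backward_ray_subset x y by (intro Un_least)
    ultimately have "K \<noteq> orbit_closure" unfolding K_def
      by (intro orbit_closure_indecomposable[OF closed_Un conn1] closed_backward_ray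
          backward_ray_subset[OF c] backward_ray_proper[OF c])
    have sub: "K \<subseteq> orbit_closure" unfolding K_def using backward_ray_subset x y c by auto
    have "closed K" unfolding K_def by (intro closed_Un closed_backward_ray)
    then have "compact K" using sub compact_orbit_closure by (metis compact_Int_closed inf.absorb2)
    have "(\<lambda>_. 0) \<in> K" "c \<in> K" "x \<in> K" "y \<in> K"
      unfolding K_def using zero_in_backward_ray[OF c] mem_backward_ray by auto
    then show "y \<in> composant (top_of_set orbit_closure) x"
      unfolding composant_def proper_subcontinuum_top_of_set
      using \<open>connected K\<close> \<open>K \<noteq> orbit_closure\<close> \<open>compact K\<close> sub curve_0_neq_zero
      by (intro UnionI[of K]) (auto simp: c_def)
  qed
qed

lemma Bellamy_continuum_orbit_closure: "Bellamy_continuum (top_of_set orbit_closure)"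
proof -
  have "composant (top_of_set orbit_closure) ` topspace (top_of_set orbit_closure) = {orbit_closure}"
    using composant_orbit_closure zero_in_orbit_closure by auto
  then show ?thesis
    unfolding Bellamy_continuum_def using indecomposable_orbit_closure by simp
qed

lemma separable_space_orbit_closure: "separable_space (top_of_set orbit_closure)"
proof -
  have "range curve \<subseteq> closure (curve ` \<rat>)"
  proof -
    have "curve ` closure \<rat> \<subseteq> closure (curve ` \<rat>)"
      by (rule image_closure_subset[OF continuous_on_curve closed_closure closure_subset])
    then show ?thesis by (simp add: Rats_closure_real)
  qed
  then have "orbit_closure = closure (curve ` \<rat>)"
    unfolding orbit_closure_def by (intro subset_antisym closure_minimal closure_mono) auto
  then have "top_of_set orbit_closure closure_of (curve ` \<rat>) = orbit_closure"
    using closure_subset[of "curve ` \<rat>"] by (simp add: closure_of_subtopology inf.absorb2)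
  then show ?thesis
    unfolding separable_space_def using countable_rat curve_in_orbit_closure
    by (intro exI[of _ "curve ` \<rat>"]) auto
qed

section \<open>Transport to sets of sets of natural numbers\<close>

lemma continuum_space_homeomorphic:
  assumes "homeomorphic_map X Y f" "continuum_space X"
  shows "continuum_space Y"
proof -
  have "X homeomorphic_space Y" using assms(1) by (rule homeomorphic_map_imp_homeomorphic_space)
  moreover obtain x y where "x \<in> topspace X" "y \<in> topspace X" "x \<noteq> y"
    using assms(2) by (auto simp: continuum_space_def)
  then have "f x \<in> topspace Y" "f y \<in> topspace Y" "f x \<noteq> f y"
    using homeomorphic_imp_surjective_map[OF assms(1)] homeomorphic_imp_injective_map[OF assms(1)]
    by (auto simp: inj_on_def)
  ultimately show ?thesis
    using assms(2) homeomorphic_compact_space homeomorphic_connected_space homeomorphic_Hausdorff_space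
    unfolding continuum_space_def by blast
qed

lemma proper_subcontinuum_homeomorphic:
  assumes f: "homeomorphic_map X Y f" and S: "proper_subcontinuum X S"
  shows "proper_subcontinuum Y (f ` S)"
proof -
  have sub: "S \<subseteq> topspace X" "S \<noteq> topspace X" and cont: "continuum_space (subtopology X S)"
    using S by (auto simp: proper_subcontinuum_def subcontinuum_def)
  note surj = homeomorphic_imp_surjective_map[OF f] and inj = homeomorphic_imp_injective_map[OF f]
  have "homeomorphic_map (subtopology X S) (subtopology Y (f ` S)) f"
    using sub surj by (intro homeomorphic_map_subtopologies[OF f]) auto
  then have "continuum_space (subtopology Y (f ` S))"
    using cont by (rule continuum_space_homeomorphic)
  moreover have "f ` S \<noteq> topspace Y"
    using inj_on_image_eq_iff[OF inj sub(1) subset_refl] sub(2) surj by simp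
  ultimately show ?thesis
    using sub surj by (auto simp: proper_subcontinuum_def subcontinuum_def)
qed

lemma Bellamy_continuum_homeomorphic:
  assumes "homeomorphic_maps X Y f g" "Bellamy_continuum X"
  shows "Bellamy_continuum Y"
proof -
  have f: "homeomorphic_map X Y f" and g: "homeomorphic_map Y X g"
    using assms(1) by (auto simp: homeomorphic_maps_map)
  have gf: "g (f x) = x" if "x \<in> topspace X" for x
    using assms(1) that by (simp add: homeomorphic_maps_def)
  have fg: "f (g y) = y" if "y \<in> topspace Y" for y
    using assms(1) that by (simp add: homeomorphic_maps_def)
  note fX = homeomorphic_imp_surjective_map[OF f] and gY = homeomorphic_imp_surjective_map[OF g]
  have "indecomposable_continuum Y"
    unfolding indecomposable_continuum_def
  proof (intro conjI notI; (elim exE conjE)?)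
    show "continuum_space Y"
      using assms(2) continuum_space_homeomorphic[OF f]
      by (simp add: Bellamy_continuum_def indecomposable_continuum_def)
    fix A B assume "proper_subcontinuum Y A" "proper_subcontinuum Y B" "topspace Y = A \<union> B"
    then have "proper_subcontinuum X (g ` A)" "proper_subcontinuum X (g ` B)"
        "topspace X = g ` A \<union> g ` B"
      using proper_subcontinuum_homeomorphic[OF g] gY by auto
    then show False
      using assms(2) by (auto simp: Bellamy_continuum_def indecomposable_continuum_def)
  qed
  have comp: "composant Y (f x) = f ` composant X x" if x: "x \<in> topspace X" for x
  proof
    show "f ` composant X x \<subseteq> composant Y (f x)"
      unfolding composant_def using proper_subcontinuum_homeomorphic[OF f] by blast
    show "composant Y (f x) \<subseteq> f ` composant X x"
    proof
      fix y assume "y \<in> composant Y (f x)"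
      then obtain S where S: "proper_subcontinuum Y S" "f x \<in> S" "y \<in> S"
        by (auto simp: composant_def)
      then have "y \<in> topspace Y" by (auto simp: proper_subcontinuum_def subcontinuum_def)
      moreover have "x \<in> g ` S" using S(2) gf[OF x] by (metis image_eqI)
      then have "g y \<in> composant X x"
        using proper_subcontinuum_homeomorphic[OF g S(1)] S(3) unfolding composant_def by blast
      ultimately show "y \<in> f ` composant X x" using fg by (metis image_eqI)
    qed
  qed
  obtain C where C: "composant X ` topspace X = {C}"
    using assms(2) unfolding Bellamy_continuum_def by (metis is_singletonI' is_singletonE empty_iff)
  have "composant Y ` topspace Y = (\<lambda>x. f ` composant X x) ` topspace X"
    unfolding fX[symmetric] image_image using comp by (intro image_cong) auto
  also have "\<dots> = {f ` C}"
    using arg_cong[OF C, of "image (image f)"] by (simp add: image_image)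
  finally have "\<exists>!D. D \<in> composant Y ` topspace Y" by simp
  with \<open>indecomposable_continuum Y\<close> show ?thesis by (simp add: Bellamy_continuum_def)
qed

text \<open>
  A topology can be copied along any map that is injective on its points.
\<close>

lemma homeomorphic_maps_pullback:
  assumes "inj_on f (topspace X)"
  shows "homeomorphic_maps X
    (pullback_topology (f ` topspace X) (inv_into (topspace X) f) X) f (inv_into (topspace X) f)"
    (is "homeomorphic_maps X ?Y f ?g")
  unfolding homeomorphic_maps_def
proof (intro conjI ballI)
  have inv: "?g (f x) = x" if "x \<in> topspace X" for x using assms that by simp
  show "continuous_map X ?Y f"
  proof (rule continuous_map_pullback')
    show "continuous_map X X (?g \<circ> f)"
      by (rule continuous_map_eq[OF continuous_map_id]) (simp add: inv)
  qed auto
  show "continuous_map ?Y X ?g"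
    using continuous_map_pullback[OF continuous_map_id, of "f ` topspace X" ?g X] by simp
  show "?g (f x) = x" if "x \<in> topspace X" for x using inv that .
  show "f (?g y) = y" if "y \<in> topspace ?Y" for y
    using that by (auto simp: topspace_pullback_topology f_inv_into_f)
qed

text \<open>
  A point of a Hausdorff space is determined by the traces of its open neighbourhoods on a dense set;
  a countable dense set is indexed by the natural numbers.
\<close>

lemma separable_Hausdorff_traces_inj:
  assumes "Hausdorff_space X" "separable_space X"
  obtains t :: "'a \<Rightarrow> nat set set" where "inj_on t (topspace X)"
proof -
  obtain D where D: "countable D" "D \<subseteq> topspace X" "X closure_of D = topspace X"
    using assms(2) unfolding separable_space_def by blast
  define t where "t = (\<lambda>x. {from_nat_into D -` U | U. openin X U \<and> x \<in> U})"
  have "inj_on t (topspace X)"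
  proof (rule inj_onI, rule ccontr)
    fix x y assume xy: "x \<in> topspace X" "y \<in> topspace X" "t x = t y" "x \<noteq> y"
    then obtain U V where UV: "openin X U" "openin X V" "x \<in> U" "y \<in> V" "disjnt U V"
      using assms(1) unfolding Hausdorff_space_def by metis
    have "from_nat_into D -` U \<in> t y" using UV xy(3) by (auto simp: t_def)
    then obtain W where W: "openin X W" "y \<in> W" "from_nat_into D -` U = from_nat_into D -` W"
      by (auto simp: t_def)
    have "y \<in> X closure_of D" using D xy by simp
    then obtain z where z: "z \<in> D" "z \<in> W \<inter> V"
      using W UV openin_Int[OF W(1) UV(2)] unfolding in_closure_of by (metis IntI)
    then obtain n where "from_nat_into D n = z" using from_nat_into_surj[OF D(1)] by blast
    then have "z \<in> U" using z W(3) by (metis IntE vimage_eq)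
    then show False using z UV(5) by (auto simp: disjnt_iff)
  qed
  then show thesis by (rule that)
qed

theorem theorem1:
  shows "\<exists>X :: (nat set set) topology. Bellamy_continuum X \<and> separable_space X"
proof -
  let ?X = "top_of_set orbit_closure"
  have "Hausdorff_space ?X"
    by (rule Hausdorff_space_subtopology[OF Hausdorff_space_euclidean_fun])
  then obtain t :: "_ \<Rightarrow> nat set set" where "inj_on t (topspace ?X)"
    using separable_space_orbit_closure by (rule separable_Hausdorff_traces_inj)
  then obtain Y g where Y: "homeomorphic_maps ?X Y t g" using homeomorphic_maps_pullback by blast
  then have "?X homeomorphic_space Y" by (auto simp: homeomorphic_space_def)
  then have "separable_space Y"
    using separable_space_orbit_closure homeomorphic_separable_space by blast
  then show ?thesis
    using Bellamy_continuum_homeomorphic[OF Y Bellamy_continuum_orbit_closure] by blast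
qed

end
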